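(* The group algebras $\mathbb{C}[\mathrm{SL}_2(\mathbb{Z}/2^2\mathbb{Z})]$ and $\mathbb{C}[\mathrm{SL}_2(\mathbb{F}_2[t]/(t^2))]$ are isomorphic.
   Context: Isomorphism means isomorphism of $\mathbb{C}$-algebras. *)

theory Defs
  imports Complex_Main "HOL-Algebra.Polynomial_Divisibility" "HOL-Number_Theory.Residues"
begin

text \<open>The quadruple \<open>(a, b, c, d)\<close> is the matrix with rows \<open>(a, b)\<close> and \<open>(c, d)\<close>.\<close>

definition SL2 :: "('a, 'm) ring_scheme \<Rightarrow> ('a \<times> 'a \<times> 'a \<times> 'a) monoid" where
  "SL2 R =
    \<lparr>carrier = {(a, b, c, d). a \<in> carrier R \<and> b \<in> carrier R \<and> c \<in> carrier R \<and> d \<in> carrier R \<and>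
        a \<otimes>\<^bsub>R\<^esub> d \<ominus>\<^bsub>R\<^esub> b \<otimes>\<^bsub>R\<^esub> c = \<one>\<^bsub>R\<^esub>},
     monoid.mult = (\<lambda>(a, b, c, d) (a', b', c', d').
       (a \<otimes>\<^bsub>R\<^esub> a' \<oplus>\<^bsub>R\<^esub> b \<otimes>\<^bsub>R\<^esub> c', a \<otimes>\<^bsub>R\<^esub> b' \<oplus>\<^bsub>R\<^esub> b \<otimes>\<^bsub>R\<^esub> d',
        c \<otimes>\<^bsub>R\<^esub> a' \<oplus>\<^bsub>R\<^esub> d \<otimes>\<^bsub>R\<^esub> c', c \<otimes>\<^bsub>R\<^esub> b' \<oplus>\<^bsub>R\<^esub> d \<otimes>\<^bsub>R\<^esub> d')),
     one = (\<one>\<^bsub>R\<^esub>, \<zero>\<^bsub>R\<^esub>, \<zero>\<^bsub>R\<^esub>, \<one>\<^bsub>R\<^esub>)\<rparr>"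

text \<open>The function \<open>f\<close> stands for the formal sum of the \<open>f g \<cdot> g\<close> over \<open>g\<close> in \<open>G\<close>; it vanishes
  outside the carrier, so that distinct functions are distinct elements.\<close>

definition group_algebra :: "('a, 'm) monoid_scheme \<Rightarrow> (complex, 'a \<Rightarrow> complex) module" where
  "group_algebra G =
    \<lparr>carrier = {f. finite {g. f g \<noteq> 0} \<and> {g. f g \<noteq> 0} \<subseteq> carrier G},
     monoid.mult = (\<lambda>f f' x.
       \<Sum>(g, h) \<in> {(g, h). f g \<noteq> 0 \<and> f' h \<noteq> 0 \<and> g \<otimes>\<^bsub>G\<^esub> h = x}. f g * f' h),
     one = (\<lambda>x. if x = \<one>\<^bsub>G\<^esub> then 1 else 0),
     zero = (\<lambda>x. 0),
     add = (\<lambda>f f' x. f x + f' x),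
     smult = (\<lambda>c f x. c * f x)\<rparr>"

definition algebra_iso :: "(complex, 'a) module \<Rightarrow> (complex, 'b) module \<Rightarrow> ('a \<Rightarrow> 'b) set" where
  "algebra_iso A B =
    {\<phi> \<in> ring_iso A B. \<forall>c. \<forall>x \<in> carrier A. \<phi> (c \<odot>\<^bsub>A\<^esub> x) = c \<odot>\<^bsub>B\<^esub> \<phi> x}"

definition is_algebra_iso :: "(complex, 'a) module \<Rightarrow> (complex, 'b) module \<Rightarrow> bool"
    (infixr \<open>\<simeq>\<^sub>\<complex>\<close> 60) where
  "A \<simeq>\<^sub>\<complex> B \<longleftrightarrow> algebra_iso A B \<noteq> {}"

definition F2_dual_numbers :: "int list set ring" where
  "F2_dual_numbers =
    (let P = poly_ring (residue_ring 2) in P Quot (PIdl\<^bsub>P\<^esub> (X\<^bsub>residue_ring 2\<^esub> [^]\<^bsub>P\<^esub> (2::nat))))"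

end

theory Submission
  imports Defs
begin

text \<open>Let \<open>z\<close> be a central involution of a group \<open>G\<close> and call the elements outside a subgroup of index two
  containing \<open>z\<close> odd. Replacing \<open>g h\<close> by \<open>z g h\<close> whenever \<open>g\<close> and \<open>h\<close> are both odd gives a
  new group with the same complex group algebra: send even \<open>g\<close> to \<open>g\<close> and odd \<open>g\<close> to
  \<open>(1 + \<i>)/2 g + (1 - \<i>)/2 z g\<close>, that is, multiply odd elements by \<open>\<i>\<close> on the summand where
  \<open>z = -1\<close>. For \<open>G = SL\<^sub>2(\<int>/4)\<close>, \<open>z = -1\<close> and the sign of \<open>SL\<^sub>2(\<int>/2) = S\<^sub>3\<close> as parity, the twisted
  group is \<open>SL\<^sub>2(F\<^sub>2[t]/(t\<^sup>2))\<close>.\<close>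

section \<open>Group algebras of finite groups\<close>

text \<open>Summing over whole carriers instead of supports gives index sets independent of
  \<open>f\<close> and \<open>f'\<close>, so that sums can be exchanged.\<close>

lemma group_algebra_mult:
  assumes "finite (carrier G)" "f \<in> carrier (group_algebra G)" "f' \<in> carrier (group_algebra G)"
  shows "(f \<otimes>\<^bsub>group_algebra G\<^esub> f') x =
    (\<Sum>g\<in>carrier G. \<Sum>h\<in>carrier G. if g \<otimes>\<^bsub>G\<^esub> h = x then f g * f' h else 0)"
proof -
  have "(f \<otimes>\<^bsub>group_algebra G\<^esub> f') x = (\<Sum>(g, h) \<in> carrier G \<times> carrier G.
      if g \<otimes>\<^bsub>G\<^esub> h = x then f g * f' h else 0)"
    unfolding group_algebra_def monoid.select_convs
    by (rule sum.mono_neutral_cong_left) (use assms in \<open>auto simp: group_algebra_def split: if_splits\<close>)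
  then show ?thesis
    by (simp add: sum.cartesian_product)
qed

text \<open>A multiplicative unital map \<open>u\<close> on the basis extends linearly to an algebra
  homomorphism because both products are bilinear. The assumptions concern bare operations, so that
  a twisted group can be source or target without its group axioms being established.\<close>

lemma algebra_isoI_linear_extension:
  fixes G :: "('a, 'm) monoid_scheme" and H :: "('b, 'n) monoid_scheme"
    and u :: "'a \<Rightarrow> 'b \<Rightarrow> complex"
  defines "\<phi> \<equiv> \<lambda>f x. \<Sum>g\<in>carrier G. f g * u g x"
  assumes fin: "finite (carrier G)" "finite (carrier H)"
    and closed: "\<And>g h. \<lbrakk>g \<in> carrier G; h \<in> carrier G\<rbrakk> \<Longrightarrow> g \<otimes>\<^bsub>G\<^esub> h \<in> carrier G"
    and one: "\<one>\<^bsub>G\<^esub> \<in> carrier G"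
    and u: "\<And>g. g \<in> carrier G \<Longrightarrow> u g \<in> carrier (group_algebra H)"
    and u_mult: "\<And>g h. \<lbrakk>g \<in> carrier G; h \<in> carrier G\<rbrakk> \<Longrightarrow> u (g \<otimes>\<^bsub>G\<^esub> h) = u g \<otimes>\<^bsub>group_algebra H\<^esub> u h"
    and u_one: "u \<one>\<^bsub>G\<^esub> = \<one>\<^bsub>group_algebra H\<^esub>"
    and bij: "bij_betw \<phi> (carrier (group_algebra G)) (carrier (group_algebra H))"
  shows "group_algebra G \<simeq>\<^sub>\<complex> group_algebra H"
proof -
  have \<phi>_closed: "\<phi> f \<in> carrier (group_algebra H)" if "f \<in> carrier (group_algebra G)" for f
    using bij that by (auto simp: bij_betw_def)
  have \<phi>_mult: "\<phi> (f \<otimes>\<^bsub>group_algebra G\<^esub> f') x = (\<phi> f \<otimes>\<^bsub>group_algebra H\<^esub> \<phi> f') x"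
    if f: "f \<in> carrier (group_algebra G)" "f' \<in> carrier (group_algebra G)" for f f' x
  proof -
    have "\<phi> (f \<otimes>\<^bsub>group_algebra G\<^esub> f') x =
      (\<Sum>k\<in>carrier G. \<Sum>g\<in>carrier G. \<Sum>h\<in>carrier G.
         if k = g \<otimes>\<^bsub>G\<^esub> h then f g * f' h * u k x else 0)"
      unfolding \<phi>_def
      by (simp add: group_algebra_mult[OF fin(1) f] sum_distrib_right if_distrib[of "\<lambda>y. y * _"] eq_commute cong: if_cong)
    \<comment> \<open>With the sum over \<open>k\<close> innermost, the condition picks the single
      term \<open>k = g h\<close>, which lies in the carrier by \<open>closed\<close>.\<close>
    also have "\<dots> = (\<Sum>g\<in>carrier G. \<Sum>h\<in>carrier G. \<Sum>k\<in>carrier G.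
         if k = g \<otimes>\<^bsub>G\<^esub> h then f g * f' h * u k x else 0)"
      by (subst sum.swap, rule sum.cong[OF refl], subst sum.swap, rule refl)
    also have "\<dots> = (\<Sum>g\<in>carrier G. \<Sum>h\<in>carrier G. f g * f' h * (u g \<otimes>\<^bsub>group_algebra H\<^esub> u h) x)"
      using fin closed by (intro sum.cong refl) (simp add: sum.delta u_mult)
    also have "\<dots> = (\<Sum>g\<in>carrier G. \<Sum>h\<in>carrier G. \<Sum>a\<in>carrier H. \<Sum>b\<in>carrier H.
        if a \<otimes>\<^bsub>H\<^esub> b = x then (f g * u g a) * (f' h * u h b) else 0)"
      by (intro sum.cong refl)
        (simp add: group_algebra_mult[OF fin(2) u u] sum_distrib_left if_distrib[of "\<lambda>y. _ * y"] mult_ac cong: if_cong)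
    \<comment> \<open>Moving the sums over \<open>H\<close> outward leaves inner sums over
      \<open>g\<close> and \<open>h\<close> that factor into coefficients of \<open>\<phi> f\<close>
      and \<open>\<phi> f'\<close>.\<close>
    also have "\<dots> = (\<Sum>g\<in>carrier G. \<Sum>a\<in>carrier H. \<Sum>b\<in>carrier H. \<Sum>h\<in>carrier G. 
        if a \<otimes>\<^bsub>H\<^esub> b = x then (f g * u g a) * (f' h * u h b) else 0)"
      by (rule sum.cong[OF refl], subst sum.swap, rule sum.cong[OF refl], subst sum.swap, rule refl)
    also have "\<dots> = (\<Sum>a\<in>carrier H. \<Sum>b\<in>carrier H. \<Sum>g\<in>carrier G. \<Sum>h\<in>carrier G. 
        if a \<otimes>\<^bsub>H\<^esub> b = x then (f g * u g a) * (f' h * u h b) else 0)"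
      by (subst sum.swap, rule sum.cong[OF refl], subst sum.swap, rule refl)
    also have "\<dots> = (\<phi> f \<otimes>\<^bsub>group_algebra H\<^esub> \<phi> f') x"
      unfolding group_algebra_mult[OF fin(2) \<phi>_closed[OF f(1)] \<phi>_closed[OF f(2)]]
      by (intro sum.cong refl) (simp add: \<phi>_def sum_product)
    finally show ?thesis .
  qed
  have "\<phi> \<in> ring_iso (group_algebra G) (group_algebra H)"
  proof (rule ring_iso_memI)
    show "\<phi> \<one>\<^bsub>group_algebra G\<^esub> = \<one>\<^bsub>group_algebra H\<^esub>"
      unfolding u_one[symmetric] using fin one
      by (auto simp: \<phi>_def group_algebra_def fun_eq_iff if_distrib[of "\<lambda>y. y * _"] cong: if_cong)
  qed (use bij \<phi>_closed \<phi>_mult in \<open>auto simp: fun_eq_iff, auto simp: \<phi>_def group_algebra_def sum.distrib ring_distribs\<close>)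
  moreover have "\<phi> (c \<odot>\<^bsub>group_algebra G\<^esub> f) = c \<odot>\<^bsub>group_algebra H\<^esub> \<phi> f" for c f
    by (simp add: \<phi>_def group_algebra_def sum_distrib_left mult.assoc fun_eq_iff)
  ultimately show ?thesis
    by (auto simp: is_algebra_iso_def algebra_iso_def)
qed

text \<open>The basis vector belonging to the group element \<open>g\<close>.\<close>

definition single :: "'a \<Rightarrow> 'a \<Rightarrow> complex" where
  "single g = (\<lambda>x. if x = g then 1 else 0)"

lemma single_closed: "g \<in> carrier G \<Longrightarrow> single g \<in> carrier (group_algebra G)"
  by (auto simp: group_algebra_def single_def)

lemma lincomb_closed:
  assumes "f \<in> carrier (group_algebra G)" "f' \<in> carrier (group_algebra G)"
  shows "(\<lambda>x. a * f x + b * f' x) \<in> carrier (group_algebra G)"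
proof -
  have "{g. a * f g + b * f' g \<noteq> 0} \<subseteq> {g. f g \<noteq> 0} \<union> {g. f' g \<noteq> 0}"
    by auto
  with assms show ?thesis
    by (auto simp: group_algebra_def intro: finite_subset)
qed

text \<open>Bilinearity for two-term combinations, the form that the images of odd elements take in
  the twisting argument.\<close>

lemma lincomb_mult:
  assumes fin: "finite (carrier G)" and "f1 \<in> carrier (group_algebra G)" "f2 \<in> carrier (group_algebra G)"
    "h1 \<in> carrier (group_algebra G)" "h2 \<in> carrier (group_algebra G)"
  shows "((\<lambda>x. a1 * f1 x + a2 * f2 x) \<otimes>\<^bsub>group_algebra G\<^esub> (\<lambda>x. b1 * h1 x + b2 * h2 x)) x =
    a1 * b1 * (f1 \<otimes>\<^bsub>group_algebra G\<^esub> h1) x + a1 * b2 * (f1 \<otimes>\<^bsub>group_algebra G\<^esub> h2) x +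
    a2 * b1 * (f2 \<otimes>\<^bsub>group_algebra G\<^esub> h1) x + a2 * b2 * (f2 \<otimes>\<^bsub>group_algebra G\<^esub> h2) x"
  unfolding group_algebra_mult[OF fin lincomb_closed[OF assms(2,3)] lincomb_closed[OF assms(4,5)]]
    group_algebra_mult[OF fin assms(2,4)] group_algebra_mult[OF fin assms(2,5)] 
    group_algebra_mult[OF fin assms(3,4)] group_algebra_mult[OF fin assms(3,5)]
    sum_distrib_left sum.distrib[symmetric]
  by (intro sum.cong refl) (simp add: algebra_simps)

lemma single_mult:
  assumes "finite (carrier G)" "g \<in> carrier G" "h \<in> carrier G"
  shows "single g \<otimes>\<^bsub>group_algebra G\<^esub> single h = single (g \<otimes>\<^bsub>G\<^esub> h)"
proof
  fix x
  have "(single g \<otimes>\<^bsub>group_algebra G\<^esub> single h) x = 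
    (\<Sum>g'\<in>carrier G. if g' = g then \<Sum>h'\<in>carrier G. if h' = h then if g \<otimes>\<^bsub>G\<^esub> h = x then 1 else 0 else 0 else 0)"
    unfolding group_algebra_mult[OF assms(1) single_closed[OF assms(2)] single_closed[OF assms(3)]]
    by (intro sum.cong refl) (auto simp: single_def intro!: sum.cong sum.neutral)
  then show "(single g \<otimes>\<^bsub>group_algebra G\<^esub> single h) x = single (g \<otimes>\<^bsub>G\<^esub> h) x"
    using assms by (simp add: single_def)
qed

lemma algebra_iso_trans [trans]:
  assumes "A \<simeq>\<^sub>\<complex> B" "B \<simeq>\<^sub>\<complex> C"
  shows "A \<simeq>\<^sub>\<complex> C"
proof -
  obtain \<phi> \<psi> where "\<phi> \<in> algebra_iso A B" "\<psi> \<in> algebra_iso B C"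
    using assms by (auto simp: is_algebra_iso_def)
  then have "\<psi> \<circ> \<phi> \<in> algebra_iso A C"
    by (auto simp: algebra_iso_def ring_iso_set_trans dest: ring_iso_memE(1))
  then show ?thesis
    by (auto simp: is_algebra_iso_def)
qed

text \<open>\<open>iso\<close> contains no condition on the unit, and no monoid laws are assumed
  from which it would follow, so preservation of the unit is a separate assumption.\<close>

lemma group_algebra_cong_iso:
  assumes \<beta>: "\<beta> \<in> iso G H" and fin: "finite (carrier G)"
    and closed: "\<And>g h. \<lbrakk>g \<in> carrier G; h \<in> carrier G\<rbrakk> \<Longrightarrow> g \<otimes>\<^bsub>G\<^esub> h \<in> carrier G"
    and one: "\<one>\<^bsub>G\<^esub> \<in> carrier G" "\<beta> \<one>\<^bsub>G\<^esub> = \<one>\<^bsub>H\<^esub>"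
  shows "group_algebra G \<simeq>\<^sub>\<complex> group_algebra H"
proof -
  have bij: "bij_betw \<beta> (carrier G) (carrier H)"
    and \<beta>_mult: "\<And>g h. \<lbrakk>g \<in> carrier G; h \<in> carrier G\<rbrakk> \<Longrightarrow> \<beta> (g \<otimes>\<^bsub>G\<^esub> h) = \<beta> g \<otimes>\<^bsub>H\<^esub> \<beta> h"
    using \<beta> by (auto simp: iso_def hom_def)
  let ?\<gamma> = "inv_into (carrier G) \<beta>"
  have closed_\<beta>: "\<beta> g \<in> carrier H" if "g \<in> carrier G" for g
    using bij that by (auto simp: bij_betw_def)
  have \<gamma>: "?\<gamma> x \<in> carrier G" "\<beta> (?\<gamma> x) = x" if "x \<in> carrier H" for x
    using bij that by (auto simp: bij_betw_def inv_into_into f_inv_into_f)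
  have \<gamma>\<beta>: "?\<gamma> (\<beta> g) = g" if "g \<in> carrier G" for g
    using bij that by (auto simp: bij_betw_def)
  have finH: "finite (carrier H)"
    using fin bij bij_betw_finite by blast
  \<comment> \<open>The linear extension of \<open>\<beta>\<close> relabels coefficients along its
    inverse; in this closed form the inverse map is pullback along \<open>\<beta>\<close>.\<close>
  have ext: "(\<Sum>g\<in>carrier G. f g * single (\<beta> g) x) = (if x \<in> carrier H then f (?\<gamma> x) else 0)" for f x
  proof (cases "x \<in> carrier H")
    case True
    have "(\<Sum>g\<in>carrier G. f g * single (\<beta> g) x) = (\<Sum>g\<in>carrier G. if g = ?\<gamma> x then f g else 0)"
      using \<gamma>[OF True] \<gamma>\<beta> by (intro sum.cong refl) (auto simp: single_def)
    with True \<gamma> fin show ?thesis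
      by simp
  qed (use closed_\<beta> in \<open>auto simp: single_def intro!: sum.neutral\<close>)
  show ?thesis
  proof (rule algebra_isoI_linear_extension[where u = "\<lambda>g. single (\<beta> g)"])
    show "bij_betw (\<lambda>f x. \<Sum>g\<in>carrier G. f g * single (\<beta> g) x)
      (carrier (group_algebra G)) (carrier (group_algebra H))"
      unfolding ext
      by (rule bij_betw_byWitness[where f' = "\<lambda>f g. if g \<in> carrier G then f (\<beta> g) else 0"])
        (auto simp: group_algebra_def \<gamma>\<beta> \<gamma> closed_\<beta> fun_eq_iff split: if_splits
          intro: finite_subset[OF _ fin] finite_subset[OF _ finH])
  qed (use fin finH closed one closed_\<beta> \<beta>_mult in \<open>auto simp: single_closed single_mult\<close>, 
      auto simp: single_def group_algebra_def)
qed

section \<open>Twisting by a central involution\<close>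

definition twist :: "('a, 'm) monoid_scheme \<Rightarrow> 'a \<Rightarrow> ('a \<Rightarrow> bool) \<Rightarrow> 'a monoid" where
  "twist G z p = \<lparr>carrier = carrier G,
     monoid.mult = (\<lambda>g h. if p g \<and> p h then z \<otimes>\<^bsub>G\<^esub> (g \<otimes>\<^bsub>G\<^esub> h) else g \<otimes>\<^bsub>G\<^esub> h),
     one = \<one>\<^bsub>G\<^esub>\<rparr>"

text \<open>For odd \<open>g\<close> and \<open>h\<close> the twisted product of the images is
  \<open>(\<alpha>^2 + \<beta>^2) z g h + 2 \<alpha> \<beta> g h\<close>, which equals
  \<open>g h\<close>, the image of the even product. If at most one factor is odd, no twist occurs
  and the centrality of \<open>z\<close> suffices.\<close>

lemma (in monoid) group_algebra_twist:
  assumes fin: "finite (carrier G)"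
    and z: "z \<in> carrier G" "z \<otimes> z = \<one>" "\<And>g. g \<in> carrier G \<Longrightarrow> g \<otimes> z = z \<otimes> g"
    and p: "\<not> p z" "\<And>g h. \<lbrakk>g \<in> carrier G; h \<in> carrier G\<rbrakk> \<Longrightarrow> p (g \<otimes> h) \<longleftrightarrow> p g \<noteq> p h"
  shows "group_algebra G \<simeq>\<^sub>\<complex> group_algebra (twist G z p)"
proof -
  let ?T = "twist G z p"
  have [simp]: "carrier ?T = carrier G"
    by (simp add: twist_def)
  have carrier_T: "carrier (group_algebra ?T) = carrier (group_algebra G)"
    by (simp add: group_algebra_def)
  have p1: "\<not> p \<one>"
    using p(2)[of \<one> \<one>] by simp
  have pz: "p (z \<otimes> g) \<longleftrightarrow> p g" if "g \<in> carrier G" for g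
    using p(2)[OF z(1)] p(1) that by simp
  have zz: "z \<otimes> (z \<otimes> g) = g" if "g \<in> carrier G" for g
    using z(1,2) that by (simp flip: m_assoc)
  \<comment> \<open>Chosen so that \<open>\<alpha> + \<beta> = 1\<close> and
    \<open>\<alpha> - \<beta> = \<i>\<close>: then \<open>\<alpha> + \<beta> z\<close> acts as 1
    where \<open>z = 1\<close> and as \<open>\<i>\<close> where \<open>z = -1\<close>.\<close>
  define \<alpha> where "\<alpha> = (1 + \<i>) / 2"
  define \<beta> where "\<beta> = (1 - \<i>) / 2"
  have [simp]: "\<alpha> * \<beta> = 1 / 2" "\<beta> * \<alpha> = 1 / 2" "\<alpha> * \<alpha> = \<i> / 2" "\<beta> * \<beta> = - \<i> / 2"
    by (auto simp: \<alpha>_def \<beta>_def field_simps)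
  then have [simp]: "\<alpha> * (\<beta> * y) = y / 2" "\<beta> * (\<alpha> * y) = y / 2"
    "\<alpha> * (\<alpha> * y) = \<i> / 2 * y" "\<beta> * (\<beta> * y) = - \<i> / 2 * y" for y
    by (simp_all only: mult.assoc[symmetric]) auto
  define u where "u g = (\<lambda>x. (if p g then \<alpha> else 1) * single g x + (if p g then \<beta> else 0) * single (z \<otimes> g) x)" for g
  have fin_T: "finite (carrier ?T)"
    using fin by simp
  have u_T: "u g \<in> carrier (group_algebra ?T)" if "g \<in> carrier G" for g
    unfolding u_def using that z(1) by (intro lincomb_closed single_closed) auto
  \<comment> \<open>Only two terms can reach \<open>x\<close>: \<open>g = x\<close> and, since
    \<open>z\<close> is an involution, \<open>g = z x\<close>.\<close>
  have ext: "(\<Sum>g\<in>carrier G. f g * u g x) = 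
      (if p x then \<alpha> * f x + \<beta> * f (z \<otimes> x) else f x)" if "x \<in> carrier G" for f x
  proof -
    have "(\<Sum>g\<in>carrier G. f g * u g x) = (\<Sum>g\<in>carrier G. if g = x then f g * (if p g then \<alpha> else 1) else 0) +
      (\<Sum>g\<in>carrier G. if g = z \<otimes> x then f g * (if p g then \<beta> else 0) else 0)"
      unfolding sum.distrib[symmetric] using that zz by (intro sum.cong refl) (auto simp: u_def single_def distrib_left)
    also have "\<dots> = f x * (if p x then \<alpha> else 1) + f (z \<otimes> x) * (if p x then \<beta> else 0)"
      using fin z(1) that pz by simp
    finally show ?thesis by simp
  qed
  have ext0: "(\<Sum>g\<in>carrier G. f g * u g x) = 0" if "x \<notin> carrier G" for f x
    using that z(1) by (intro sum.neutral) (auto simp: u_def single_def)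
  have ext_iff: "(\<Sum>g\<in>carrier G. f g * u g x) =
      (if x \<in> carrier G then if p x then \<alpha> * f x + \<beta> * f (z \<otimes> x) else f x else 0)" for f x
    using ext ext0 by simp
  show ?thesis
  proof (rule algebra_isoI_linear_extension[where u = u])
    fix g h assume gh: "g \<in> carrier G" "h \<in> carrier G"
    show "u (g \<otimes> h) = u g \<otimes>\<^bsub>group_algebra ?T\<^esub> u h"
    proof
      fix x
      have [simp]: "g \<otimes> (z \<otimes> h) = z \<otimes> (g \<otimes> h)" "z \<otimes> g \<otimes> (z \<otimes> h) = g \<otimes> h" 
        using gh z zz by (metis m_assoc m_closed)+
      have [simp]: "z \<otimes> g \<otimes> h = z \<otimes> (g \<otimes> h)" 
        using gh z(1) by (simp add: m_assoc)
      have *: "(u g \<otimes>\<^bsub>group_algebra ?T\<^esub> u h) x = 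
        (if p g then \<alpha> else 1) * (if p h then \<alpha> else 1) * single (g \<otimes>\<^bsub>?T\<^esub> h) x +
        (if p g then \<alpha> else 1) * (if p h then \<beta> else 0) * single (g \<otimes>\<^bsub>?T\<^esub> (z \<otimes> h)) x +
        (if p g then \<beta> else 0) * (if p h then \<alpha> else 1) * single (z \<otimes> g \<otimes>\<^bsub>?T\<^esub> h) x +
        (if p g then \<beta> else 0) * (if p h then \<beta> else 0) * single (z \<otimes> g \<otimes>\<^bsub>?T\<^esub> (z \<otimes> h)) x"
        unfolding u_def using gh z(1) fin
        by (subst lincomb_mult) (auto simp: single_mult intro!: single_closed)
      show "u (g \<otimes> h) x = (u g \<otimes>\<^bsub>group_algebra ?T\<^esub> u h) x"
        unfolding * using gh z(1) by (auto simp: u_def twist_def pz p zz algebra_simps)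
    qed
  next
    show "u \<one> = \<one>\<^bsub>group_algebra ?T\<^esub>"
      using p1 by (auto simp: u_def single_def group_algebra_def twist_def)
    show "bij_betw (\<lambda>f x. \<Sum>g\<in>carrier G. f g * u g x) (carrier (group_algebra G)) (carrier (group_algebra ?T))"
    \<comment> \<open>Swapping \<alpha> and \<beta> replaces the factor \<open>\<i>\<close> on odd
      elements by its inverse \<open>-\<i>\<close>.\<close>
    proof (rule bij_betw_byWitness[where f' = "\<lambda>f x. if x \<in> carrier G then if p x then \<beta> * f x + \<alpha> * f (z \<otimes> x) else f x else 0"])
    qed (auto simp: ext_iff fun_eq_iff pz zz z(1) group_algebra_def distrib_left split: if_splits
        intro: finite_subset[OF _ fin])
  qed (use fin u_T in auto)
qed


section \<open>Dual numbers and special linear groups\<close>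

text \<open>The pair \<open>(a, b)\<close> stands for \<open>a + b t\<close> with
  \<open>t^2 = 0\<close>, a concrete model of \<open>R[t]/(t^2)\<close>.\<close>

definition dual_numbers :: "('a, 'm) ring_scheme \<Rightarrow> ('a \<times> 'a) ring" where
  "dual_numbers R =
    \<lparr>carrier = carrier R \<times> carrier R,
     monoid.mult = (\<lambda>(a, b) (c, d). (a \<otimes>\<^bsub>R\<^esub> c, a \<otimes>\<^bsub>R\<^esub> d \<oplus>\<^bsub>R\<^esub> b \<otimes>\<^bsub>R\<^esub> c)),
     one = (\<one>\<^bsub>R\<^esub>, \<zero>\<^bsub>R\<^esub>),
     zero = (\<zero>\<^bsub>R\<^esub>, \<zero>\<^bsub>R\<^esub>),
     add = (\<lambda>(a, b) (c, d). (a \<oplus>\<^bsub>R\<^esub> c, b \<oplus>\<^bsub>R\<^esub> d))\<rparr>"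

lemma (in cring) cring_dual_numbers: "cring (dual_numbers R)"
proof (rule cringI)
  show "abelian_group (dual_numbers R)"
  proof (rule abelian_groupI)
    fix x assume "x \<in> carrier (dual_numbers R)"
    then show "\<exists>y\<in>carrier (dual_numbers R). y \<oplus>\<^bsub>dual_numbers R\<^esub> x = \<zero>\<^bsub>dual_numbers R\<^esub>"
      by (intro bexI[of _ "(\<ominus> fst x, \<ominus> snd x)"]) (auto simp: dual_numbers_def l_neg)
  qed (auto simp: dual_numbers_def a_ac)
  show "comm_monoid (dual_numbers R)"
    by (rule comm_monoidI) (auto simp: dual_numbers_def m_ac a_ac l_distr r_distr)
qed (auto simp: dual_numbers_def l_distr a_ac)

text \<open>First isomorphism theorem for the map taking a polynomial to its constant and linear
  coefficients; the kernel consists of the multiples of \<open>X^2\<close>.\<close>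

lemma (in domain) dual_numbers_iso_quotient:
  defines "P \<equiv> poly_ring R"
  shows "\<exists>h. h \<in> ring_iso (P Quot (PIdl\<^bsub>P\<^esub> (X\<^bsub>R\<^esub> [^]\<^bsub>P\<^esub> (2::nat)))) (dual_numbers R)"
proof -
  let ?h = "\<lambda>p. (coeff p 0, coeff p 1)"
  interpret P: cring P
    unfolding P_def by (rule univ_poly_is_cring[OF carrier_is_subring])
  interpret D: cring "dual_numbers R"
    by (rule cring_dual_numbers)
  have carrier_P: "p \<in> carrier P \<longleftrightarrow> polynomial (carrier R) p" for p
    by (simp add: P_def univ_poly_carrier)
  have set_P: "set p \<subseteq> carrier R" if "p \<in> carrier P" for p
    using that carrier_P polynomial_in_carrier[OF carrier_is_subring] by blast
  have X_closed: "X\<^bsub>R\<^esub> \<in> carrier P"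
    unfolding P_def by (rule var_closed(1)[OF carrier_is_subring])
  \<comment> \<open>Polynomials are coefficient lists with the leading coefficient first and
    \<open>[]\<close> for zero, so multiplying by \<open>X\<close> appends a zero, except to
    \<open>[]\<close>.\<close>
  have mult_X2: "p \<otimes>\<^bsub>P\<^esub> (X\<^bsub>R\<^esub> [^]\<^bsub>P\<^esub> (2::nat)) = (if p = [] then [] else p @ [\<zero>, \<zero>])" if p: "p \<in> carrier P" for p
  proof -
    have "p \<otimes>\<^bsub>P\<^esub> (X\<^bsub>R\<^esub> [^]\<^bsub>P\<^esub> (2::nat)) = (p \<otimes>\<^bsub>P\<^esub> X\<^bsub>R\<^esub>) \<otimes>\<^bsub>P\<^esub> X\<^bsub>R\<^esub>"
      using p X_closed by (simp add: numeral_2_eq_2 P.m_assoc)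
    moreover have "q \<otimes>\<^bsub>P\<^esub> X\<^bsub>R\<^esub> = (if q = [] then [] else q @ [\<zero>])" if "q \<in> carrier P" for q
      using poly_mult_var[OF carrier_is_subring] that by (simp add: P_def)
    ultimately show ?thesis
      using p X_closed P.m_closed[OF p X_closed] by (auto split: if_splits)
  qed
  interpret ring_hom_ring P "dual_numbers R" ?h
  proof (rule ring_hom_ringI2[OF P.ring_axioms D.ring_axioms ring_hom_memI])
    show "?h p \<in> carrier (dual_numbers R)" if "p \<in> carrier P" for p
      using set_P[OF that] by (simp add: dual_numbers_def)
    show "?h \<one>\<^bsub>P\<^esub> = \<one>\<^bsub>dual_numbers R\<^esub>"
      by (simp add: P_def univ_poly_one dual_numbers_def)
    fix p q assume p: "p \<in> carrier P" and q: "q \<in> carrier P"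
    have c: "coeff p i \<in> carrier R" "coeff q i \<in> carrier R" for i
      using set_P p q by auto
    have *: "{..0::nat} = {0}" "{..Suc 0} = {0, Suc 0}"
      by auto
    show "?h (p \<otimes>\<^bsub>P\<^esub> q) = ?h p \<otimes>\<^bsub>dual_numbers R\<^esub> ?h q"
      using c by (simp add: P_def univ_poly_mult poly_mult_coeff[OF set_P[OF p] set_P[OF q]] dual_numbers_def *)
    show "?h (p \<oplus>\<^bsub>P\<^esub> q) = ?h p \<oplus>\<^bsub>dual_numbers R\<^esub> ?h q"
      using c by (simp add: P_def univ_poly_add poly_add_coeff[OF set_P[OF p] set_P[OF q]] dual_numbers_def
        del: poly_add.simps)
  qed
  have "(a, b) \<in> ?h ` carrier P" if "a \<in> carrier R" "b \<in> carrier R" for a b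
  proof (rule image_eqI)
    \<comment> \<open>The preimage is \<open>b X + a\<close>; \<open>normalize\<close> removes
      leading zeros, which occur when \<open>b\<close> is zero.\<close>
    show "(a, b) = ?h (normalize [b, a])"
      unfolding normalize_coeff[symmetric] by simp
    show "normalize [b, a] \<in> carrier P"
      unfolding carrier_P by (rule normalize_gives_polynomial) (use that in simp)
  qed
  then have surj: "?h ` carrier P = carrier (dual_numbers R)"
    using hom_closed by (auto simp: dual_numbers_def)
  have X2_multiple: "(if p = [] then [] else p @ [\<zero>, \<zero>]) \<in> PIdl\<^bsub>P\<^esub> (X\<^bsub>R\<^esub> [^]\<^bsub>P\<^esub> (2::nat))"
    if "p \<in> carrier P" for p
    unfolding mult_X2[OF that, symmetric] cgenideal_def using that by blast
  have "a_kernel P (dual_numbers R) ?h = PIdl\<^bsub>P\<^esub> (X\<^bsub>R\<^esub> [^]\<^bsub>P\<^esub> (2::nat))"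
  proof (intro equalityI subsetI)
    fix p assume "p \<in> a_kernel P (dual_numbers R) ?h"
    then have p: "p \<in> carrier P" and c: "coeff p 0 = \<zero>" "coeff p 1 = \<zero>"
      by (auto simp: a_kernel_def' dual_numbers_def)
    show "p \<in> PIdl\<^bsub>P\<^esub> (X\<^bsub>R\<^esub> [^]\<^bsub>P\<^esub> (2::nat))"
    \<comment> \<open>The last two entries are the linear and constant coefficients. Both vanish, so
      what precedes them is the quotient by \<open>X^2\<close>; the nonzero leading coefficient
      excludes lists of length one and an empty rest.\<close>
    proof (cases p rule: rev_cases)
      case Nil
      then show ?thesis
        using X2_multiple[of "[]"] carrier_P by (simp add: polynomial_def)
    next
      case (snoc r y)
      note r = snoc
      show ?thesis
      proof (cases r rule: rev_cases)
        case Nil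
        then show ?thesis
          using r p c carrier_P by (simp add: polynomial_def)
      next
        case (snoc q x)
        with r c have p_eq: "p = q @ [\<zero>, \<zero>]"
          by (auto simp: append_coeff)
        moreover from this p have "q \<noteq> []"
          using carrier_P by (auto simp: polynomial_def)
        moreover from p_eq p this have "q \<in> carrier P"
          using carrier_P by (auto simp: polynomial_def)
        ultimately show ?thesis
          using X2_multiple[of q] by simp
      qed
    qed
  next
    fix p assume "p \<in> PIdl\<^bsub>P\<^esub> (X\<^bsub>R\<^esub> [^]\<^bsub>P\<^esub> (2::nat))"
    then obtain q where q: "q \<in> carrier P" "p = q \<otimes>\<^bsub>P\<^esub> (X\<^bsub>R\<^esub> [^]\<^bsub>P\<^esub> (2::nat))"
      by (auto simp: cgenideal_def)
    then have "p \<in> carrier P"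
      using X_closed by simp
    with q show "p \<in> a_kernel P (dual_numbers R) ?h"
      by (auto simp: mult_X2 a_kernel_def' dual_numbers_def append_coeff)
  qed
  with FactRing_iso_set[OF surj] show ?thesis
    by auto
qed

section \<open>Special linear groups over rings\<close>

lemma (in ring) minus_eq_iff:
  assumes "x \<in> carrier R" "y \<in> carrier R" "z \<in> carrier R"
  shows "x \<ominus> y = z \<longleftrightarrow> x = z \<oplus> y"
  using assms by (metis a_minus_def add.inv_solve_right)

text \<open>Without subtraction, the determinant condition uses only operations that ring
  homomorphisms preserve by definition and that unfold directly in the concrete rings.\<close>

lemma (in ring) carrier_SL2:
  "carrier (SL2 R) = {(a, b, c, d). a \<in> carrier R \<and> b \<in> carrier R \<and> c \<in> carrier R \<and> d \<in> carrier R \<and>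
     a \<otimes> d = \<one> \<oplus> b \<otimes> c}"
  by (auto simp: SL2_def minus_eq_iff)

text \<open>Closure is the multiplicativity of the determinant.\<close>

lemma (in cring) SL2_monoid: "monoid (SL2 R)"
proof (rule monoidI)
  fix g h assume "g \<in> carrier (SL2 R)" "h \<in> carrier (SL2 R)"
  moreover obtain a b c d a' b' c' d' where g: "g = (a, b, c, d)" "h = (a', b', c', d')"
    by (metis prod_cases4)
  ultimately have c: "a \<in> carrier R" "b \<in> carrier R" "c \<in> carrier R" "d \<in> carrier R"
      "a' \<in> carrier R" "b' \<in> carrier R" "c' \<in> carrier R" "d' \<in> carrier R"
    and det: "a \<otimes> d \<ominus> b \<otimes> c = \<one>" "a' \<otimes> d' \<ominus> b' \<otimes> c' = \<one>"
    by (auto simp: SL2_def)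
  have "(a \<otimes> a' \<oplus> b \<otimes> c') \<otimes> (c \<otimes> b' \<oplus> d \<otimes> d') \<ominus> (a \<otimes> b' \<oplus> b \<otimes> d') \<otimes> (c \<otimes> a' \<oplus> d \<otimes> c')
    = (a \<otimes> d \<ominus> b \<otimes> c) \<otimes> (a' \<otimes> d' \<ominus> b' \<otimes> c')"
    using c by algebra
  then have "(a \<otimes> a' \<oplus> b \<otimes> c') \<otimes> (c \<otimes> b' \<oplus> d \<otimes> d') \<ominus> (a \<otimes> b' \<oplus> b \<otimes> d') \<otimes> (c \<otimes> a' \<oplus> d \<otimes> c') = \<one>"
    by (simp add: det)
  with c show "g \<otimes>\<^bsub>SL2 R\<^esub> h \<in> carrier (SL2 R)"
    by (simp add: g SL2_def)
qed (auto simp: SL2_def l_distr r_distr m_assoc a_ac a_minus_def)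

text \<open>Applied entrywise, \<open>h\<close> preserves the determinant equation as a homomorphism
  and reflects it by injectivity; reflection places entrywise preimages back in
  \<open>SL2 R\<close>.\<close>

lemma SL2_iso:
  assumes "ring R" "ring S" "h \<in> ring_iso R S"
  shows "(\<lambda>(a, b, c, d). (h a, h b, h c, h d)) \<in> iso (SL2 R) (SL2 S)"
proof -
  interpret R: ring R by fact
  interpret S: ring S by fact
  have h: "\<And>x. x \<in> carrier R \<Longrightarrow> h x \<in> carrier S"
    "\<And>x y. \<lbrakk>x \<in> carrier R; y \<in> carrier R\<rbrakk> \<Longrightarrow> h (x \<otimes>\<^bsub>R\<^esub> y) = h x \<otimes>\<^bsub>S\<^esub> h y"
    "\<And>x y. \<lbrakk>x \<in> carrier R; y \<in> carrier R\<rbrakk> \<Longrightarrow> h (x \<oplus>\<^bsub>R\<^esub> y) = h x \<oplus>\<^bsub>S\<^esub> h y"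
    "h \<one>\<^bsub>R\<^esub> = \<one>\<^bsub>S\<^esub>" and bij: "bij_betw h (carrier R) (carrier S)"
    using ring_iso_memE[OF assms(3)] by auto
  have inj: "h x = h y \<longleftrightarrow> x = y" if "x \<in> carrier R" "y \<in> carrier R" for x y
    using bij that by (auto simp: bij_betw_def inj_on_eq_iff)
  have det: "h a \<otimes>\<^bsub>S\<^esub> h d = \<one>\<^bsub>S\<^esub> \<oplus>\<^bsub>S\<^esub> h b \<otimes>\<^bsub>S\<^esub> h c \<longleftrightarrow> a \<otimes>\<^bsub>R\<^esub> d = \<one>\<^bsub>R\<^esub> \<oplus>\<^bsub>R\<^esub> b \<otimes>\<^bsub>R\<^esub> c"
    if "a \<in> carrier R" "b \<in> carrier R" "c \<in> carrier R" "d \<in> carrier R" for a b c d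
    using that inj[of "a \<otimes>\<^bsub>R\<^esub> d" "\<one>\<^bsub>R\<^esub> \<oplus>\<^bsub>R\<^esub> b \<otimes>\<^bsub>R\<^esub> c"] by (simp add: h)
  have "bij_betw (\<lambda>(a, b, c, d). (h a, h b, h c, h d)) (carrier (SL2 R)) (carrier (SL2 S))"
    unfolding bij_betw_def
  proof
    show "inj_on (\<lambda>(a, b, c, d). (h a, h b, h c, h d)) (carrier (SL2 R))"
      by (auto simp: inj_on_def R.carrier_SL2 inj)
    have surj: "\<exists>x\<in>carrier R. y = h x" if "y \<in> carrier S" for y
      using bij that by (auto simp: bij_betw_def)
    show "(\<lambda>(a, b, c, d). (h a, h b, h c, h d)) ` carrier (SL2 R) = carrier (SL2 S)"
    proof (intro equalityI subsetI)
      fix y assume y: "y \<in> carrier (SL2 S)"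
      obtain a' b' c' d' where y_eq: "y = (a', b', c', d')"
        by (metis prod_cases4)
      with y have "a' \<in> carrier S" "b' \<in> carrier S" "c' \<in> carrier S" "d' \<in> carrier S"
        by (auto simp: S.carrier_SL2)
      then obtain a b c d where "a \<in> carrier R" "b \<in> carrier R" "c \<in> carrier R" "d \<in> carrier R"
          "y = (h a, h b, h c, h d)"
        unfolding y_eq using surj by metis
      with y show "y \<in> (\<lambda>(a, b, c, d). (h a, h b, h c, h d)) ` carrier (SL2 R)"
        by (intro image_eqI[of _ _ "(a, b, c, d)"]) (auto simp: R.carrier_SL2 S.carrier_SL2 det)
    qed (auto simp: R.carrier_SL2 S.carrier_SL2 det h(1))
  qed
  then show ?thesis
    unfolding iso_def hom_def
    by (auto simp: R.carrier_SL2 S.carrier_SL2 det h) (auto simp: SL2_def h)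
qed

section \<open>The two groups of order 48\<close>

text \<open>Modulo 2, this is the sign character of \<open>SL\<^sub>2(F\<^sub>2) = S\<^sub>3\<close> written as a polynomial.\<close>

definition parity :: "int \<times> int \<times> int \<times> int \<Rightarrow> bool" where
  "parity = (\<lambda>(a, b, c, d). odd (a + b + c + d + b * c))"

text \<open>The isomorphism is \<open>A + 2 B \<mapsto> A + t (B + F A)\<close> for 0-1 matrices \<open>A\<close> and \<open>B\<close>, where
  \<open>F = ((c d, a c), (c + b d, a b))\<close> was found by search: \<open>F\<close> is constrained only by its values
  on the six matrices in \<open>SL\<^sub>2(F\<^sub>2)\<close>. The pair \<open>(x, y)\<close> stands for \<open>x + t y\<close>.\<close>

definition to_dual ::
    "int \<times> int \<times> int \<times> int \<Rightarrow> (int \<times> int) \<times> (int \<times> int) \<times> (int \<times> int) \<times> (int \<times> int)" where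
  "to_dual = (\<lambda>(a, b, c, d).
     ((a mod 2, (a div 2 + c * d) mod 2), (b mod 2, (b div 2 + a * c) mod 2),
      (c mod 2, (c div 2 + c + b * d) mod 2), (d mod 2, (d div 2 + a * b) mod 2)))"

text \<open>The correction \<open>F A\<close> depends only on \<open>A\<close>, which
  \<open>to_dual\<close> keeps, and adding it twice gives zero in characteristic 2, so the same
  correction serves for the inverse.\<close>

definition of_dual ::
    "(int \<times> int) \<times> (int \<times> int) \<times> (int \<times> int) \<times> (int \<times> int) \<Rightarrow> int \<times> int \<times> int \<times> int" where
  "of_dual = (\<lambda>((a, a'), (b, b'), (c, c'), (d, d')).
     (a + 2 * ((a' + c * d) mod 2), b + 2 * ((b' + a * c) mod 2),
      c + 2 * ((c' + c + b * d) mod 2), d + 2 * ((d' + a * b) mod 2)))"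

text \<open>An executable form of the matrix product, unfolded to integer arithmetic.\<close>

definition mult_Z4 where
  "mult_Z4 = (\<lambda>(a::int, b, c, d) (a', b', c', d').
     ((a * a' + b * c') mod 4, (a * b' + b * d') mod 4, (c * a' + d * c') mod 4, (c * b' + d * d') mod 4))"

text \<open>For dual numbers over the field of two elements, \<open>dot_dual x y z w\<close> is
  \<open>x y + z w\<close>, the shape of an entry of a matrix product.\<close>

definition dot_dual where
  "dot_dual = (\<lambda>(a::int, a') (b, b') (c, c') (d, d').
     ((a * b + c * d) mod 2, (a * b' + a' * b + (c * d' + c' * d)) mod 2))"

definition mult_dual where
  "mult_dual = (\<lambda>(a, b, c, d) (a', b', c', d').
     (dot_dual a a' b c', dot_dual a b' b d', dot_dual c a' d c', dot_dual c b' d d'))"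

text \<open>Membership is kept as a predicate next to the enumeration because \<open>code_simp\<close> would
  recompute the enumeration at each membership test.\<close>

definition quadruple_in :: "'a list \<Rightarrow> 'a \<times> 'a \<times> 'a \<times> 'a \<Rightarrow> bool" where
  "quadruple_in xs = (\<lambda>(a, b, c, d). a \<in> set xs \<and> b \<in> set xs \<and> c \<in> set xs \<and> d \<in> set xs)"

definition quadruples :: "'a list \<Rightarrow> ('a \<times> 'a \<times> 'a \<times> 'a) list" where
  "quadruples xs = List.product xs (List.product xs (List.product xs xs))"

definition F2_dual :: "(int \<times> int) list" where
  "F2_dual = [(0, 0), (0, 1), (1, 0), (1, 1)]"

definition det_Z4 :: "int \<times> int \<times> int \<times> int \<Rightarrow> bool" where
  "det_Z4 = (\<lambda>(a, b, c, d). (a * d) mod 4 = (1 + b * c) mod 4)"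

text \<open>Padding with zeros and ones lets \<open>dot_dual\<close> express \<open>a d\<close> and
  \<open>1 + b c\<close>.\<close>

definition det_dual :: "(int \<times> int) \<times> (int \<times> int) \<times> (int \<times> int) \<times> (int \<times> int) \<Rightarrow> bool" where
  "det_dual = (\<lambda>(a, b, c, d). dot_dual a d (0, 0) (0, 0) = dot_dual (1, 0) (1, 0) b c)"

definition SL2_Z4 :: "(int \<times> int \<times> int \<times> int) list" where
  "SL2_Z4 = filter det_Z4 (quadruples [0, 1, 2, 3])"

definition SL2_dual :: "((int \<times> int) \<times> (int \<times> int) \<times> (int \<times> int) \<times> (int \<times> int)) list" where
  "SL2_dual = filter det_dual (quadruples F2_dual)"

lemma set_quadruples: "set (quadruples xs) = Collect (quadruple_in xs)"
  by (auto simp: quadruples_def quadruple_in_def)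

lemma cring_residue_ring: "m > 1 \<Longrightarrow> cring (residue_ring m)"
  by (rule residues.cring) (simp add: residues_def)

text \<open>Identifies the abstract carrier with an explicit list, so that claims about the group
  become finite checks.\<close>

lemma carrier_SL2_Z4: "carrier (SL2 (residue_ring 4)) = set SL2_Z4"
proof -
  interpret cring "residue_ring 4"
    by (rule cring_residue_ring) simp
  have "carrier (residue_ring 4) = set [0, 1, 2, 3]"
    by (auto simp: residue_ring_def)
  moreover have "a \<otimes>\<^bsub>residue_ring 4\<^esub> d = \<one>\<^bsub>residue_ring 4\<^esub> \<oplus>\<^bsub>residue_ring 4\<^esub> b \<otimes>\<^bsub>residue_ring 4\<^esub> c \<longleftrightarrow>
      det_Z4 (a, b, c, d)" for a b c d
    by (simp add: residue_ring_def det_Z4_def mod_simps)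
  ultimately show ?thesis
    unfolding carrier_SL2 SL2_Z4_def set_filter set_quadruples quadruple_in_def by blast
qed

lemma carrier_SL2_dual: "carrier (SL2 (dual_numbers (residue_ring 2))) = set SL2_dual"
proof -
  let ?D = "dual_numbers (residue_ring 2)"
  interpret cring ?D
    by (intro cring.cring_dual_numbers cring_residue_ring) simp
  have "{0..1} = {0, 1::int}"
    by auto
  then have "carrier ?D = set F2_dual"
    by (auto simp: dual_numbers_def residue_ring_def F2_dual_def)
  moreover have "a \<otimes>\<^bsub>?D\<^esub> d = \<one>\<^bsub>?D\<^esub> \<oplus>\<^bsub>?D\<^esub> b \<otimes>\<^bsub>?D\<^esub> c \<longleftrightarrow> det_dual (a, b, c, d)" for a b c d
    by (cases a; cases b; cases c; cases d)
      (simp add: dual_numbers_def residue_ring_def det_dual_def dot_dual_def mod_simps)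
  ultimately show ?thesis
    unfolding carrier_SL2 SL2_dual_def set_filter set_quadruples quadruple_in_def by blast
qed

lemma mult_SL2_Z4: "g \<otimes>\<^bsub>SL2 (residue_ring 4)\<^esub> h = mult_Z4 g h"
  by (simp add: SL2_def residue_ring_def mult_Z4_def mod_simps split: prod.splits)

lemma mult_SL2_dual: "g \<otimes>\<^bsub>SL2 (dual_numbers (residue_ring 2))\<^esub> h = mult_dual g h"
  by (simp add: SL2_def residue_ring_def dual_numbers_def mult_dual_def dot_dual_def mod_simps
      split: prod.splits)

section \<open>Finite verification over the explicit lists\<close>

text \<open>The argument of \<open>to_dual\<close> on the left is the twisted product, since
  \<open>(3, 0, 0, 3)\<close> is minus the identity modulo 4. The check runs through all pairs of
  the 48 matrices.\<close>

lemma to_dual_mult: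
  "\<forall>g\<in>set SL2_Z4. \<forall>h\<in>set SL2_Z4.
     to_dual (if parity g \<and> parity h then mult_Z4 (3, 0, 0, 3) (mult_Z4 g h) else mult_Z4 g h) =
       mult_dual (to_dual g) (to_dual h)"
  by code_simp

text \<open>Makes \<open>parity\<close> a homomorphism to the group of order two, as twisting
  requires.\<close>

lemma parity_mult:
  "\<forall>g\<in>set SL2_Z4. \<forall>h\<in>set SL2_Z4. parity (mult_Z4 g h) \<longleftrightarrow> parity g \<noteq> parity h"
  by code_simp

lemma minus_one_central:
  "\<forall>g\<in>set SL2_Z4. mult_Z4 g (3, 0, 0, 3) = mult_Z4 (3, 0, 0, 3) g"
  by code_simp

text \<open>Landing in the other group is part of the check, so that together with
  \<open>of_dual_inverse\<close> it yields mutually inverse bijections.\<close>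

lemma to_dual_inverse:
  "\<forall>g\<in>set SL2_Z4. (quadruple_in F2_dual (to_dual g) \<and> det_dual (to_dual g)) \<and> of_dual (to_dual g) = g"
  by code_simp

lemma of_dual_inverse:
  "\<forall>x\<in>set SL2_dual. (quadruple_in [0, 1, 2, 3] (of_dual x) \<and> det_Z4 (of_dual x)) \<and> to_dual (of_dual x) = x"
  by code_simp

lemma SL2_twist_iso:
  "to_dual \<in> iso (twist (SL2 (residue_ring 4)) (3, 0, 0, 3) parity) (SL2 (dual_numbers (residue_ring 2)))"
    (is "_ \<in> iso ?T ?H")
proof (rule isoI)
  have carrier: "carrier ?T = set SL2_Z4" "carrier ?H = set SL2_dual"
    by (simp_all add: twist_def carrier_SL2_Z4 carrier_SL2_dual)
  show "bij_betw to_dual (carrier ?T) (carrier ?H)"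
    unfolding carrier using to_dual_inverse of_dual_inverse
    by (intro bij_betw_byWitness[where f' = of_dual])
      (simp_all add: SL2_Z4_def SL2_dual_def set_quadruples image_subset_iff)
  then show "to_dual \<in> hom ?T ?H"
  proof (intro homI)
    fix g h assume "g \<in> carrier ?T" "h \<in> carrier ?T"
    then have "to_dual (if parity g \<and> parity h then mult_Z4 (3, 0, 0, 3) (mult_Z4 g h) else mult_Z4 g h) =
        mult_dual (to_dual g) (to_dual h)"
      using to_dual_mult unfolding carrier by blast
    then show "to_dual (g \<otimes>\<^bsub>?T\<^esub> h) = to_dual g \<otimes>\<^bsub>?H\<^esub> to_dual h"
      by (simp only: twist_def monoid.select_convs mult_SL2_Z4 mult_SL2_dual)
  qed (auto simp only: bij_betw_def)
qed

theorem mainTheorem6: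
  shows "group_algebra (SL2 (residue_ring (2 ^ 2))) \<simeq>\<^sub>\<complex> group_algebra (SL2 F2_dual_numbers)"
proof -
  let ?G = "SL2 (residue_ring 4)"
  let ?T = "twist ?G (3, 0, 0, 3) parity"
  let ?D = "dual_numbers (residue_ring 2)"
  interpret Z4: cring "residue_ring 4"
    by (rule cring_residue_ring) simp
  interpret G: monoid ?G
    by (rule Z4.SL2_monoid)
  interpret F2: domain "residue_ring 2"
    using residues_prime.is_field[of 2] by (simp add: residues_prime_def field_def)
  interpret D: cring ?D
    by (rule F2.cring_dual_numbers)
  interpret H: monoid "SL2 ?D"
    by (rule D.SL2_monoid)
  have fin: "finite (carrier ?G)"
    by (simp add: carrier_SL2_Z4)
  have one: "\<one>\<^bsub>?G\<^esub> = (1, 0, 0, 1)"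
    by (simp add: SL2_def residue_ring_def)
  have z: "(3, 0, 0, 3) \<in> carrier ?G"
    unfolding carrier_SL2_Z4 by code_simp
  have "group_algebra ?G \<simeq>\<^sub>\<complex> group_algebra ?T"
  proof (rule G.group_algebra_twist[OF fin z])
    show "(3, 0, 0, 3) \<otimes>\<^bsub>?G\<^esub> (3, 0, 0, 3) = \<one>\<^bsub>?G\<^esub>"
      by (simp add: mult_SL2_Z4 mult_Z4_def one)
    show "\<not> parity (3, 0, 0, 3)"
      by (simp add: parity_def)
    fix g assume g: "g \<in> carrier ?G"
    then show "g \<otimes>\<^bsub>?G\<^esub> (3, 0, 0, 3) = (3, 0, 0, 3) \<otimes>\<^bsub>?G\<^esub> g"
      using minus_one_central by (simp only: mult_SL2_Z4 carrier_SL2_Z4)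
    fix h assume "h \<in> carrier ?G"
    with g show "parity (g \<otimes>\<^bsub>?G\<^esub> h) \<longleftrightarrow> parity g \<noteq> parity h"
      using parity_mult by (simp only: mult_SL2_Z4 carrier_SL2_Z4)
  qed
  also have "group_algebra ?T \<simeq>\<^sub>\<complex> group_algebra (SL2 ?D)"
  proof (rule group_algebra_cong_iso[OF SL2_twist_iso])
    show "finite (carrier ?T)"
      using fin by (simp add: twist_def)
    show "g \<otimes>\<^bsub>?T\<^esub> h \<in> carrier ?T" if "g \<in> carrier ?T" "h \<in> carrier ?T" for g h
      using that z G.m_closed by (simp add: twist_def del: split_paired_All)
    show "\<one>\<^bsub>?T\<^esub> \<in> carrier ?T"
      using G.one_closed by (simp add: twist_def)
    have "\<one>\<^bsub>?T\<^esub> = (1, 0, 0, 1)"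
      using one by (simp add: twist_def)
    then show "to_dual \<one>\<^bsub>?T\<^esub> = \<one>\<^bsub>SL2 ?D\<^esub>"
      by (simp add: to_dual_def SL2_def dual_numbers_def residue_ring_def)
  qed
  also have "group_algebra (SL2 ?D) \<simeq>\<^sub>\<complex> group_algebra (SL2 F2_dual_numbers)"
  proof -
    let ?P = "poly_ring (residue_ring 2)"
    let ?I = "PIdl\<^bsub>?P\<^esub> (X\<^bsub>residue_ring 2\<^esub> [^]\<^bsub>?P\<^esub> (2::nat))"
    interpret P: cring ?P
      by (rule F2.univ_poly_is_cring[OF F2.carrier_is_subring])
    have "ideal ?I ?P"
      using F2.var_closed(1)[OF F2.carrier_is_subring] by (intro P.cgenideal_ideal) simp
    then have Q: "ring F2_dual_numbers"
      unfolding F2_dual_numbers_def Let_def by (rule ideal.quotient_is_ring)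
    obtain h where "h \<in> ring_iso F2_dual_numbers ?D"
      using F2.dual_numbers_iso_quotient by (auto simp: F2_dual_numbers_def Let_def)
    \<comment> \<open>The first isomorphism theorem gives a map out of the quotient, while the chain
      of isomorphisms has to lead from \<open>?D\<close> to the quotient.\<close>
    then have h: "inv_into (carrier F2_dual_numbers) h \<in> ring_iso ?D F2_dual_numbers"
      by (rule ring_iso_set_sym[OF Q])
    let ?k = "inv_into (carrier F2_dual_numbers) h"
    \<comment> \<open>The unit matrix has zeros as well as ones among its entries, so its
      preservation rests on both constants.\<close>
    have "?k \<one>\<^bsub>?D\<^esub> = \<one>\<^bsub>F2_dual_numbers\<^esub>" "?k \<zero>\<^bsub>?D\<^esub> = \<zero>\<^bsub>F2_dual_numbers\<^esub>"
      using ring_iso_memE(4)[OF h] ring_hom_zero[OF _ D.ring_axioms Q] h by (auto simp: ring_iso_def)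
    then have "(case \<one>\<^bsub>SL2 ?D\<^esub> of (a, b, c, d) \<Rightarrow> (?k a, ?k b, ?k c, ?k d)) = \<one>\<^bsub>SL2 F2_dual_numbers\<^esub>"
      by (simp add: SL2_def)
    moreover have "finite (carrier (SL2 ?D))"
      by (simp only: carrier_SL2_dual finite_set)
    ultimately show ?thesis
      by (intro group_algebra_cong_iso[OF SL2_iso[OF D.ring_axioms Q h]] H.m_closed H.one_closed)
  qed
  \<comment> \<open>Only the modulus remains to be evaluated, \<open>2 ^ 2\<close> being 4.\<close>
  finally show ?thesis
    by simp
qed

end
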